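(* For every $n\ge1$ and every $0\le k<n$, the number of involutions $\pi$ of $\{1,\dots,n\}$ that avoid the pattern $321$ and have exactly $k$ descents is $\binom{\lceil n/2\rceil}{k}\binom{\lfloor n/2\rfloor}{k}$.
   Context: A permutation $\pi$ of $\{1,\dots,n\}$ is an involution if $\pi=\pi^{-1}$; it avoids $321$ if there are no $i<j<k$ with $\pi(i)>\pi(j)>\pi(k)$. A descent of $\pi$ is an index $1\le i<n$ with $\pi(i)>\pi(i+1)$. *)

theory Defs
  imports Complex_Main "HOL-Combinatorics.Permutations"
begin

text \<open>
  A permutation of \<open>{1..n}\<close> is a function on \<open>nat\<close> with \<open>\<pi> permutes {1..n}\<close>, i.e. a bijection
  that is the identity outside \<open>{1..n}\<close>; thus permutations of \<open>{1..n}\<close> correspond to exactly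
  one such function each, and there are finitely many of them.
\<close>

definition involutions :: "nat \<Rightarrow> (nat \<Rightarrow> nat) set" where
  "involutions n = {\<pi>. \<pi> permutes {1..n} \<and> \<pi> = inv \<pi>}"

definition avoids_321 :: "nat \<Rightarrow> (nat \<Rightarrow> nat) \<Rightarrow> bool" where
  "avoids_321 n \<pi> \<longleftrightarrow>
     \<not> (\<exists>i\<in>{1..n}. \<exists>j\<in>{1..n}. \<exists>k\<in>{1..n}. i < j \<and> j < k \<and> \<pi> i > \<pi> j \<and> \<pi> j > \<pi> k)"

definition descents :: "nat \<Rightarrow> (nat \<Rightarrow> nat) \<Rightarrow> nat set" where
  "descents n \<pi> = {i. 1 \<le> i \<and> i < n \<and> \<pi> i > \<pi> (i + 1)}"

end

theory Submission
  imports Defs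
begin

text \<open>
  An involution avoids 321 iff it is weakly increasing on weak excedances and on weak deficiencies,
  i.e. iff its arcs are pairwise non-nesting and no fixed point lies under an arc. Such an involution
  is determined by the set \<open>S\<close> of right ends of its arcs: reading from right to left, the number
  of arcs over each gap is forced, hence so are the left ends, and the arcs match left and right ends
  in increasing order. The sets \<open>S\<close> that arise are the ballot sets, and the descents are
  the \<open>i \<notin> S\<close> with \<open>i + 1 \<in> S\<close>, i.e. the peaks of the ballot path.

  With \<open>q\<close> down steps and \<open>p = n - q\<close> up steps, a recurrence on the last two steps shows
  that there are \<open>(p choose k) (q choose k) - (p + 1 choose k) (q - 1 choose k)\<close> ballot paths with
  \<open>k\<close> peaks; the sum over \<open>q\<close> telescopes.
\<close>

subsection \<open>Counting ballot sets by peaks\<close>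

text \<open>Elements of \<open>S\<close> are down steps, all other positions up steps; the prefix
  condition keeps the path from going below its starting level.\<close>

definition ballot :: "nat \<Rightarrow> nat set \<Rightarrow> bool" where
  "ballot n S \<longleftrightarrow> S \<subseteq> {1..n} \<and> (\<forall>m\<le>n. 2 * card (S \<inter> {1..m}) \<le> m)"

definition peaks :: "nat \<Rightarrow> nat set \<Rightarrow> nat set" where
  "peaks n S = {i. 1 \<le> i \<and> i < n \<and> i \<notin> S \<and> Suc i \<in> S}"

definition ballots :: "nat \<Rightarrow> nat \<Rightarrow> nat \<Rightarrow> nat set set" where
  "ballots n q k = {S. ballot n S \<and> card S = q \<and> card (peaks n S) = k}"

lemma finite_peaks [simp]: "finite (peaks n S)"
  by (rule finite_subset[of _ "{..n}"]) (auto simp: peaks_def)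

lemma finite_ballots [simp]: "finite (ballots n q k)"
  by (rule finite_subset[of _ "Pow {1..n}"]) (auto simp: ballots_def ballot_def)

lemma ballot_subset: "ballot n S \<Longrightarrow> S \<subseteq> {1..n}"
  by (simp add: ballot_def)

lemma ballot_card: "ballot n S \<Longrightarrow> 2 * card S \<le> n"
  unfolding ballot_def by (metis inf.absorb1 order_refl)

lemma ballot_Suc_iff:
  assumes "S \<subseteq> {1..n}"
  shows "ballot (Suc n) S \<longleftrightarrow> ballot n S"
proof -
  have "S \<inter> {1..Suc n} = S \<inter> {1..n}" using assms by auto
  then show ?thesis using assms by (auto simp: ballot_def le_Suc_eq)
qed

lemma ballot_insert_iff:
  assumes "S \<subseteq> {1..n}"
  shows "ballot (Suc n) (insert (Suc n) S) \<longleftrightarrow> ballot n S \<and> 2 * Suc (card S) \<le> Suc n"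
proof -
  have fin: "finite S" and notin: "Suc n \<notin> S"
    using assms finite_subset by fastforce+
  have 1: "insert (Suc n) S \<inter> {1..Suc n} = insert (Suc n) S" using assms by auto
  have 2: "insert (Suc n) S \<inter> {1..m} = S \<inter> {1..m}" if "m \<le> n" for m using that by auto
  have "(\<forall>m\<le>Suc n. P m) \<longleftrightarrow> (\<forall>m\<le>n. P m) \<and> P (Suc n)" for P
    by (auto simp: le_Suc_eq)
  note this[of "\<lambda>m. 2 * card (insert (Suc n) S \<inter> {1..m}) \<le> m", unfolded 1]
  moreover have "(\<forall>m\<le>n. 2 * card (insert (Suc n) S \<inter> {1..m}) \<le> m) \<longleftrightarrow>
                 (\<forall>m\<le>n. 2 * card (S \<inter> {1..m}) \<le> m)"
    using 2 by simp
  ultimately show ?thesis using assms fin notin by (auto simp: ballot_def)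
qed

lemma peaks_Suc: "S \<subseteq> {1..n} \<Longrightarrow> peaks (Suc n) S = peaks n S"
  by (auto simp: peaks_def less_Suc_eq)

lemma peaks_insert:
  assumes "S \<subseteq> {1..Suc n}"
  shows "peaks (Suc (Suc n)) (insert (Suc (Suc n)) S) =
         (if Suc n \<in> S then peaks (Suc n) S else insert (Suc n) (peaks n S))"
  using assms by (auto simp: peaks_def less_Suc_eq)

text \<open>A final up step affects neither the ballot condition nor the number of down steps and
  peaks, so deleting it leaves the set itself unchanged.\<close>

lemma ballots_notin: "{S \<in> ballots (Suc n) q k. Suc n \<notin> S} = ballots n q k"
proof -
  have "S \<subseteq> {1..n}" if "S \<subseteq> {1..Suc n}" "Suc n \<notin> S" for S
    using that by (metis atLeastAtMostSuc_conv le_add1 plus_1_eq_Suc subset_insert)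
  then have sub: "S \<subseteq> {1..n}" if "S \<in> ballots (Suc n) q k \<and> Suc n \<notin> S \<or> S \<in> ballots n q k" for S
    using that by (auto simp only: ballots_def ballot_def mem_Collect_eq)
  have "S \<in> ballots (Suc n) q k \<longleftrightarrow> S \<in> ballots n q k" if "S \<subseteq> {1..n}" for S
    using that by (simp add: ballots_def ballot_Suc_iff peaks_Suc)
  moreover have "Suc n \<notin> S" if "S \<in> ballots n q k" for S
    using that by (auto simp: ballots_def ballot_def)
  ultimately show ?thesis using sub by blast
qed

text \<open>Deleting the second of two final down steps loses no peak. The paths that remain must
  still end in a down step, which by \<open>ballots_notin\<close> is the set difference. The
  assumption supplies the ballot inequality at the full length.\<close>

lemma ballots_both:
  assumes "2 * q \<le> n"
  shows "{S \<in> ballots (Suc (Suc n)) (Suc q) k. Suc (Suc n) \<in> S \<and> Suc n \<in> S}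
         = insert (Suc (Suc n)) ` (ballots (Suc n) q k - ballots n q k)" (is "?L = ?R")
proof -
  have *: "insert (Suc (Suc n)) S \<in> ballots (Suc (Suc n)) (Suc q) k \<longleftrightarrow> S \<in> ballots (Suc n) q k"
    if "S \<subseteq> {1..Suc n}" "Suc n \<in> S" for S
  proof -
    have "finite S" "Suc (Suc n) \<notin> S" using that finite_subset by fastforce+
    then show ?thesis
      using that assms by (auto simp: ballots_def ballot_insert_iff peaks_insert)
  qed
  have **: "ballots (Suc n) q k - ballots n q k = {S \<in> ballots (Suc n) q k. Suc n \<in> S}"
    using ballots_notin[of n q k] by blast
  show ?thesis
  proof (intro equalityI subsetI)
    fix T assume T: "T \<in> ?L"
    define S where "S = T - {Suc (Suc n)}"
    have "T = insert (Suc (Suc n)) S" "S \<subseteq> {1..Suc n}" "Suc n \<in> S"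
      using T by (auto simp: S_def ballots_def ballot_def le_Suc_eq)
    then show "T \<in> ?R" using T * ** by blast
  next
    fix T assume "T \<in> ?R"
    then obtain S where S: "T = insert (Suc (Suc n)) S" "S \<in> ballots (Suc n) q k" "Suc n \<in> S"
      unfolding ** by blast
    then have "S \<subseteq> {1..Suc n}" by (simp add: ballots_def ballot_def)
    then show "T \<in> ?L" using S * by simp
  qed
qed

text \<open>Deleting a final up-down pair loses exactly the peak between the two steps. The guard
  \<open>k \<noteq> 0\<close> matters because \<open>k - 1\<close> truncates.\<close>

lemma ballots_peak:
  assumes "2 * q \<le> n"
  shows "{S \<in> ballots (Suc (Suc n)) (Suc q) k. Suc (Suc n) \<in> S \<and> Suc n \<notin> S}
         = insert (Suc (Suc n)) ` {S. k \<noteq> 0 \<and> S \<in> ballots n q (k - 1)}" (is "?L = ?R")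
proof -
  have *: "insert (Suc (Suc n)) S \<in> ballots (Suc (Suc n)) (Suc q) k
           \<longleftrightarrow> k \<noteq> 0 \<and> S \<in> ballots n q (k - 1)"
    if "S \<subseteq> {1..n}" for S
  proof -
    have "finite S" "Suc (Suc n) \<notin> S" "Suc n \<notin> S" using that finite_subset by fastforce+
    moreover have "S \<subseteq> {1..Suc n}" using that by auto
    moreover have "Suc n \<notin> peaks n S" by (auto simp: peaks_def)
    ultimately show ?thesis
      using that assms
      by (auto simp: ballots_def ballot_insert_iff ballot_Suc_iff peaks_insert)
  qed
  show ?thesis
  proof (intro equalityI subsetI)
    fix T assume T: "T \<in> ?L"
    define S where "S = T - {Suc (Suc n)}"
    have "T = insert (Suc (Suc n)) S" "S \<subseteq> {1..n}"
      using T by (auto simp: S_def ballots_def ballot_def le_Suc_eq)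
    then show "T \<in> ?R" using T * by blast
  next
    fix T assume "T \<in> ?R"
    then obtain S where S: "T = insert (Suc (Suc n)) S" "k \<noteq> 0" "S \<in> ballots n q (k - 1)" by blast
    then have "S \<subseteq> {1..n}" by (simp add: ballots_def ballot_def)
    then show "T \<in> ?L" using S * by auto
  qed
qed

text \<open>Three cases by the last two steps: final up, down-down, up-down. The integers make room
  for the subtraction coming from down-down.\<close>

lemma card_ballots_rec:
  assumes "2 * q \<le> n"
  shows "int (card (ballots (Suc (Suc n)) (Suc q) k)) =
           int (card (ballots (Suc n) (Suc q) k)) + int (card (ballots (Suc n) q k))
           - int (card (ballots n q k)) + (if k = 0 then 0 else int (card (ballots n q (k - 1))))"
proof -
  let ?B = "ballots (Suc (Suc n)) (Suc q) k"
  let ?N = "{S \<in> ?B. Suc (Suc n) \<notin> S}"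
  let ?D = "{S \<in> ?B. Suc (Suc n) \<in> S \<and> Suc n \<in> S}"
  let ?P = "{S \<in> ?B. Suc (Suc n) \<in> S \<and> Suc n \<notin> S}"
  have notin: "Suc (Suc n) \<notin> S" if "S \<in> ballots (Suc n) a b \<or> S \<in> ballots n a b" for S a b
    using that by (auto simp: ballots_def dest!: ballot_subset)
  have inj: "inj_on (insert (Suc (Suc n))) X" if "\<And>S. S \<in> X \<Longrightarrow> Suc (Suc n) \<notin> S" for X
    using that by (auto intro!: inj_onI simp: insert_ident)
  have "card ?B = card (?N \<union> (?D \<union> ?P))" by (rule arg_cong[where f = card]) blast
  also have "\<dots> = card ?N + (card ?D + card ?P)"
    by (subst card_Un_disjoint; (subst card_Un_disjoint)?; auto)
  also have "card ?N = card (ballots (Suc n) (Suc q) k)"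
    by (simp only: ballots_notin)
  finally have 1: "card ?B = card (ballots (Suc n) (Suc q) k) + (card ?D + card ?P)" .
  have "card ?D = card (ballots (Suc n) q k - ballots n q k)"
    unfolding ballots_both[OF assms] by (intro card_image inj) (use notin in blast)
  moreover have sub: "ballots n q k \<subseteq> ballots (Suc n) q k" using ballots_notin[of n q k] by blast
  ultimately have 2: "int (card ?D) = int (card (ballots (Suc n) q k)) - int (card (ballots n q k))"
    by (simp add: card_Diff_subset card_mono of_nat_diff)
  have "card ?P = card {S. k \<noteq> 0 \<and> S \<in> ballots n q (k - 1)}"
    unfolding ballots_peak[OF assms] by (intro card_image inj) (use notin in blast)
  then have 3: "int (card ?P) = (if k = 0 then 0 else int (card (ballots n q (k - 1))))"
    by simp
  show ?thesis using 1 2 3 by simp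
qed

section \<open>Closed form of the ballot counts\<close>

lemma ballots_0: "ballots n 0 k = (if k = 0 then {{}} else {})"
proof -
  have "S \<in> ballots n 0 k \<longleftrightarrow> S = {} \<and> k = 0" for S
    by (cases "finite S") (auto simp: ballots_def ballot_def peaks_def dest: finite_subset)
  then show ?thesis by auto
qed

lemma ballots_empty: "n < 2 * q \<Longrightarrow> ballots n q k = {}"
  by (auto simp: ballots_def dest!: ballot_card)

text \<open>
  Number of unrestricted lattice paths with \<open>p\<close> up and \<open>q\<close> down steps and \<open>k\<close> peaks: a path is
  determined by the coordinates of its peaks.
\<close>
definition grid :: "nat \<Rightarrow> nat \<Rightarrow> nat \<Rightarrow> int" where
  "grid k p q = int (p choose k) * int (q choose k)"

text \<open>Pascal's rule in both factors; this has the same shape as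
  \<open>card_ballots_rec\<close>.\<close>

lemma grid_rec:
  "grid k (Suc p) (Suc q) = grid k p (Suc q) + grid k (Suc p) q - grid k p q
     + (if k = 0 then 0 else grid (k - 1) p q)"
  by (cases k) (simp_all add: grid_def algebra_simps)

text \<open>Both grid terms obey \<open>grid_rec\<close>, so their difference obeys the ballot
  recurrence. The hypothesis reaches one step past the possible sizes of ballot sets, to the line
  where the count vanishes.\<close>

lemma card_ballots_Suc:
  "2 * q < n \<Longrightarrow> int (card (ballots n (Suc q) k)) = grid k (n - Suc q) (Suc q) - grid k (n - q) q"
proof (induction n arbitrary: q k rule: less_induct)
  case (less n)
  show ?case
  proof (cases "n = 2 * q + 1")
    \<comment> \<open>On this boundary the two grid terms are equal by symmetry, and no ballot set
      is that large.\<close>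
    case True
    then show ?thesis by (simp add: ballots_empty grid_def)
  next
    case False
    with less.prems obtain m where n: "n = Suc (Suc m)" and m: "2 * q \<le> m"
      by (intro that[of "n - 2"]) linarith+
    have A1: "int (card (ballots (Suc m) (Suc q) k)) = grid k (m - q) (Suc q) - grid k (Suc m - q) q"
      using less.IH[of "Suc m" q k] m n by simp
    show ?thesis
    proof (cases q)
      \<comment> \<open>The induction hypothesis speaks of \<open>Suc\<close> many down steps only,
        so the counts with no down step are evaluated directly.\<close>
      case 0
      then show ?thesis
        using card_ballots_rec[OF m, of k] A1 n
        by (cases "k = 0"; cases "k = 1") (auto simp: ballots_0 grid_def binomial_eq_0)
    next
      case (Suc r)
      obtain p where p: "m = p + q" using m that[of "m - q"] by linarith
      have A2: "int (card (ballots (Suc m) q k)) = grid k (Suc p) q - grid k (Suc (Suc p)) r"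
        using less.IH[of "Suc m" r k] m n p Suc by (simp add: Suc_diff_le)
      have A3: "int (card (ballots m q j)) = grid j p q - grid j (Suc p) r" for j
        using less.IH[of m r j] m n p Suc by (simp add: Suc_diff_le)
      \<comment> \<open>The two instances of \<open>grid_rec\<close> treat the leading and the
        subtracted grid term.\<close>
      show ?thesis
        using card_ballots_rec[OF m, of k] A1 A2 A3[of k] A3[of "k - 1"] n p Suc
          grid_rec[of k p q] grid_rec[of k "Suc p" r]
        by (auto simp: Suc_diff_le split: if_splits)
    qed
  qed
qed

text \<open>The subtracted term for \<open>Suc q\<close> is the leading term for \<open>q\<close>.
  The sum starts at the empty set, which \<open>grid k n 0\<close> counts.\<close>

lemma sum_card_ballots:
  "2 * q \<le> n \<Longrightarrow> (\<Sum>r\<le>q. int (card (ballots n r k))) = grid k (n - q) q"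
proof (induction q)
  case 0
  then show ?case by (simp add: ballots_0 grid_def)
next
  case (Suc q)
  then show ?case using card_ballots_Suc[of q n k] by simp
qed

lemma card_ballot_peaks:
  "card {S. ballot n S \<and> card (peaks n S) = k} = ((n - n div 2) choose k) * ((n div 2) choose k)"
proof -
  have "{S. ballot n S \<and> card (peaks n S) = k} = (\<Union>r\<le>n div 2. ballots n r k)"
    using ballot_card by (force simp: ballots_def)
  then have "card {S. ballot n S \<and> card (peaks n S) = k} = (\<Sum>r\<le>n div 2. card (ballots n r k))"
    by (simp only:) (subst card_UN_disjoint, simp_all, auto simp: ballots_def)
  then have "int (card {S. ballot n S \<and> card (peaks n S) = k}) = grid k (n - n div 2) (n div 2)"
    using sum_card_ballots[of "n div 2" n k] by simp
  then show ?thesis unfolding grid_def by (metis of_nat_eq_iff of_nat_mult)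
qed

subsection \<open>The structure of avoiding involutions\<close>

lemma card_Int_Suc:
  "card (X \<inter> {1..Suc m}) = card (X \<inter> {1..m}) + (if Suc m \<in> X then 1 else 0)"
proof -
  have "X \<inter> {1..Suc m} = (if Suc m \<in> X then insert (Suc m) (X \<inter> {1..m}) else X \<inter> {1..m})"
    by (auto simp: le_Suc_eq)
  then show ?thesis by auto
qed

lemma card_Int_mono: "i \<le> j \<Longrightarrow> card (X \<inter> {1..i}) \<le> card (X \<inter> {1..j::nat})"
  by (rule card_mono) auto

lemma card_Int_strict: "i < j \<Longrightarrow> j \<in> X \<Longrightarrow> card (X \<inter> {1..i}) < card (X \<inter> {1..j::nat})"
  using card_Int_mono[of i "j - 1" X] card_Int_Suc[of X "j - 1"] by (cases j) auto

text \<open>For \<open>x\<close> in \<open>X\<close>, \<open>card (X \<inter> {1..x})\<close> is the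
  rank of \<open>x\<close>, which strictly increases along \<open>X\<close>.\<close>

lemma rank_inj:
  assumes "card (X \<inter> {1..x}) = card (X \<inter> {1..y})" "x \<in> X" "y \<in> X"
  shows "x = (y :: nat)"
  using assms card_Int_strict[of x y X] card_Int_strict[of y x X]
  by (cases x y rule: linorder_cases) auto

text \<open>\<open>h i\<close> stands for the number of arcs over the gap between \<open>i\<close>
  and \<open>i + 1\<close>. A position outside \<open>S\<close> with height 0 there cannot begin an
  arc, so it is meant to be a fixed point.\<close>

definition openers :: "nat \<Rightarrow> nat set \<Rightarrow> (nat \<Rightarrow> nat) \<Rightarrow> nat set" where
  "openers n S h = {i \<in> {1..n}. i \<notin> S \<and> h i > 0}"

definition closers :: "(nat \<Rightarrow> nat) \<Rightarrow> nat set" where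
  "closers \<pi> = {i. \<pi> i < i}"

text \<open>Each arc over the gap between \<open>m\<close> and \<open>m + 1\<close> is counted by
  its right end.\<close>

definition arcs :: "(nat \<Rightarrow> nat) \<Rightarrow> nat \<Rightarrow> nat" where
  "arcs \<pi> m = card {i \<in> closers \<pi>. m < i \<and> \<pi> i \<le> m}"

context
  fixes n :: nat and \<pi> :: "nat \<Rightarrow> nat"
  assumes inv: "\<pi> \<in> involutions n" and avoid: "avoids_321 n \<pi>"
begin

lemma involution_permutes: "\<pi> permutes {1..n}"
  using inv by (simp add: involutions_def)

lemma involutive: "\<pi> (\<pi> i) = i"
  using inv permutes_inverses(2)[OF involution_permutes, of i] by (simp add: involutions_def)

lemma involution_in_range_iff: "\<pi> i \<in> {1..n} \<longleftrightarrow> i \<in> {1..n}"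
  using permutes_in_image[OF involution_permutes] .

lemma involution_eq_iff: "\<pi> i = \<pi> j \<longleftrightarrow> i = j"
  using permutes_inj[OF involution_permutes] by (simp add: inj_eq)

lemma no_321: "\<lbrakk>i < j; j < k; \<pi> i > \<pi> j; \<pi> j > \<pi> k; i \<in> {1..n}; j \<in> {1..n}; k \<in> {1..n}\<rbrakk> \<Longrightarrow> False"
  using avoid unfolding avoids_321_def by blast

text \<open>Otherwise the positions \<open>i < j < \<pi> i\<close> carry the values
  \<open>\<pi> i > \<pi> j > i\<close>, a 321 pattern. Only the right position has to be a weak
  excedance, which is what the analysis of descents uses.\<close>

lemma mono_weak_excedances:
  assumes "i < j" "j \<le> \<pi> j" "i \<in> {1..n}" "j \<in> {1..n}"
  shows "\<pi> i < \<pi> j"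
proof (rule ccontr)
  assume "\<not> \<pi> i < \<pi> j"
  moreover have "\<pi> i \<noteq> \<pi> j" using assms involution_eq_iff by auto
  ultimately have "\<pi> j < \<pi> i" by simp
  then show False
    using no_321[of i j "\<pi> i"] assms involution_in_range_iff[of i] by (auto simp: involutive)
qed

text \<open>Mirror image: otherwise the positions \<open>\<pi> j < i < j\<close> carry the values
  \<open>j > \<pi> i > \<pi> j\<close>.\<close>

lemma mono_weak_deficiencies:
  assumes "i < j" "\<pi> i \<le> i" "i \<in> {1..n}" "j \<in> {1..n}"
  shows "\<pi> i < \<pi> j"
proof (rule ccontr)
  assume "\<not> \<pi> i < \<pi> j"
  moreover have "\<pi> i \<noteq> \<pi> j" using assms involution_eq_iff by auto
  ultimately have "\<pi> j < \<pi> i" by simp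
  then show False
    using no_321[of "\<pi> j" i j] assms involution_in_range_iff[of j] by (auto simp: involutive)
qed

lemma closers_subset: "closers \<pi> \<subseteq> {1..n}"
proof
  fix i assume "i \<in> closers \<pi>"
  then have "\<pi> i \<noteq> i" by (simp add: closers_def)
  then show "i \<in> {1..n}" using involution_permutes by (meson permutes_not_in)
qed

lemma finite_closers: "finite (closers \<pi>)"
  using closers_subset finite_subset by blast

text \<open>Within each prefix, \<open>\<pi>\<close> injects the right ends into the remaining
  positions, by sending them to their left ends.\<close>

lemma ballot_closers: "ballot n (closers \<pi>)"
  unfolding ballot_def
proof (intro conjI allI impI closers_subset)
  fix m assume "m \<le> n"
  let ?S = "closers \<pi> \<inter> {1..m}"
  have "\<pi> ` ?S \<subseteq> {1..m} - ?S"
  proof (rule image_subsetI)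
    fix i assume i: "i \<in> ?S"
    then have "\<pi> i \<in> {1..n}" using involution_in_range_iff[of i] closers_subset by blast
    then show "\<pi> i \<in> {1..m} - ?S" using i by (simp add: closers_def involutive)
  qed
  then have "card (\<pi> ` ?S) \<le> card ({1..m} - ?S)" by (simp add: card_mono)
  moreover have "card (\<pi> ` ?S) = card ?S" by (simp add: card_image inj_on_def involution_eq_iff)
  moreover have "card ({1..m} - ?S) = m - card ?S" by (subst card_Diff_subset) auto
  moreover have "card ?S \<le> m" using card_mono[of "{1..m}" ?S] by simp
  ultimately show "2 * card ?S \<le> m" by linarith
qed

text \<open>At a descent the two monotonicity lemmas force \<open>\<pi> i > i\<close> and
  \<open>\<pi> (Suc i) < Suc i\<close>. Conversely
  \<open>\<pi> (Suc i) \<le> i \<le> \<pi> i\<close>, and injectivity makes this strict.\<close>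

lemma descents_eq_peaks: "descents n \<pi> = peaks n (closers \<pi>)"
proof -
  have "\<pi> i > \<pi> (Suc i) \<longleftrightarrow> i \<notin> closers \<pi> \<and> Suc i \<in> closers \<pi>" if "1 \<le> i" "i < n" for i
  proof
    assume "\<pi> i > \<pi> (Suc i)"
    then have "\<not> Suc i \<le> \<pi> (Suc i)" "\<not> \<pi> i \<le> i"
      using that mono_weak_excedances[of i "Suc i"] mono_weak_deficiencies[of i "Suc i"] by auto
    then show "i \<notin> closers \<pi> \<and> Suc i \<in> closers \<pi>"
      by (simp add: closers_def)
  next
    assume "i \<notin> closers \<pi> \<and> Suc i \<in> closers \<pi>"
    moreover have "\<pi> i \<noteq> \<pi> (Suc i)" by (simp add: involution_eq_iff)
    ultimately show "\<pi> i > \<pi> (Suc i)" by (simp add: closers_def)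
  qed
  then show ?thesis by (auto simp: descents_def peaks_def)
qed

lemma arcs_n: "arcs \<pi> n = 0"
proof -
  have "{i \<in> closers \<pi>. n < i \<and> \<pi> i \<le> n} = {}" using closers_subset by auto
  then show ?thesis by (simp only: arcs_def card.empty)
qed

lemma arcs_fixed:
  assumes "\<pi> f = f" "f \<in> {1..n}"
  shows "{i \<in> closers \<pi>. f < i \<and> \<pi> i \<le> f} = {}"
proof -
  have "f < \<pi> i" if "i \<in> closers \<pi>" "f < i" for i
    using mono_weak_deficiencies[of f i] that assms closers_subset by auto
  then show ?thesis by (simp add: set_eq_iff not_le)
qed

text \<open>Moving left past a right end enters its arc, past a left end leaves one. At a fixed
  point both counts are 0 by \<open>arcs_fixed\<close>, in accordance with truncated subtraction.
  The second claim tells fixed points from left ends.\<close>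

lemma arcs_step:
  assumes "Suc m \<le> n"
  shows "arcs \<pi> m = (if Suc m \<in> closers \<pi> then arcs \<pi> (Suc m) + 1 else arcs \<pi> (Suc m) - 1)"
    and "Suc m \<notin> closers \<pi> \<Longrightarrow> \<pi> (Suc m) = Suc m \<longleftrightarrow> arcs \<pi> (Suc m) = 0"
proof -
  let ?A = "\<lambda>m. {i \<in> closers \<pi>. m < i \<and> \<pi> i \<le> m}"
  have fin: "finite (?A m)" for m using finite_closers by simp
  have m: "Suc m \<in> {1..n}" using assms by simp
  consider "\<pi> (Suc m) < Suc m" | "\<pi> (Suc m) = Suc m" | "\<pi> (Suc m) > Suc m" by linarith
  then have "arcs \<pi> m = (if Suc m \<in> closers \<pi> then arcs \<pi> (Suc m) + 1 else arcs \<pi> (Suc m) - 1) \<and>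
    (Suc m \<notin> closers \<pi> \<longrightarrow> (\<pi> (Suc m) = Suc m \<longleftrightarrow> arcs \<pi> (Suc m) = 0))"
  proof cases
    case 1
    have "\<pi> i \<noteq> Suc m" if "Suc m < i" for i
      using 1 that by (metis involutive less_asym)
    then have "?A m = insert (Suc m) (?A (Suc m))"
      using 1 by (fastforce simp: closers_def)
    then have "arcs \<pi> m = arcs \<pi> (Suc m) + 1"
      unfolding arcs_def using fin[of "Suc m"] by simp
    then show ?thesis using 1 by (simp add: closers_def)
  next
    case 2
    have "?A m \<subseteq> ?A (Suc m)"
    proof
      fix i assume i: "i \<in> ?A m"
      then have "i \<noteq> Suc m" using 2 by auto
      then show "i \<in> ?A (Suc m)" using i by simp
    qed
    moreover have "?A (Suc m) = {}" using arcs_fixed[OF 2 m] .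
    ultimately have "arcs \<pi> m = 0" "arcs \<pi> (Suc m) = 0" unfolding arcs_def by (simp_all only: subset_empty card.empty)
    then show ?thesis using 2 by (simp add: closers_def)
  next
    case 3
    \<comment> \<open>The one arc over the right gap but not the left one begins at
      \<open>Suc m\<close>, and its right end is \<open>\<pi> (Suc m)\<close>.\<close>
    have "i \<in> ?A (Suc m) \<longleftrightarrow> i \<in> insert (\<pi> (Suc m)) (?A m)" for i
    proof (cases "i = \<pi> (Suc m)")
      case True
      then show ?thesis using 3 by (simp add: closers_def involutive)
    next
      case False
      then have "\<pi> i \<noteq> Suc m" by (metis involutive)
      moreover have "m < i \<longleftrightarrow> Suc m < i" if "i \<in> closers \<pi>"
        using that 3 by (metis Suc_lessD Suc_lessI closers_def less_asym mem_Collect_eq)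
      ultimately show ?thesis using False by (auto simp: le_Suc_eq)
    qed
    then have "?A (Suc m) = insert (\<pi> (Suc m)) (?A m)" by blast
    moreover have "\<pi> (Suc m) \<notin> ?A m" by (simp add: involutive)
    ultimately have "arcs \<pi> (Suc m) = arcs \<pi> m + 1"
      unfolding arcs_def using fin[of m] by simp
    then show ?thesis using 3 by (simp add: closers_def)
  qed
  then show "arcs \<pi> m = (if Suc m \<in> closers \<pi> then arcs \<pi> (Suc m) + 1 else arcs \<pi> (Suc m) - 1)"
    and "Suc m \<notin> closers \<pi> \<Longrightarrow> \<pi> (Suc m) = Suc m \<longleftrightarrow> arcs \<pi> (Suc m) = 0" by blast+
qed

text \<open>Recovers the left ends from the right ends and the arc counts alone.\<close>

lemma image_closers: "\<pi> ` closers \<pi> = openers n (closers \<pi>) (arcs \<pi>)"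
proof -
  have "\<pi> ` closers \<pi> = {i. i < \<pi> i}"
    by (auto simp: closers_def image_iff involutive) (metis involutive)
  also have "\<dots> = {i \<in> {1..n}. i \<notin> closers \<pi> \<and> \<pi> i \<noteq> i}"
    using permutes_not_in[OF involution_permutes] by (fastforce simp: closers_def)
  also have "\<dots> = openers n (closers \<pi>) (arcs \<pi>)"
  proof -
    have "\<pi> i \<noteq> i \<longleftrightarrow> arcs \<pi> i > 0" if "i \<in> {1..n}" "i \<notin> closers \<pi>" for i
      using arcs_step(2)[of "i - 1"] that by simp
    then show ?thesis by (auto simp only: openers_def mem_Collect_eq)
  qed
  finally show ?thesis .
qed

text \<open>Since \<open>\<pi>\<close> increases on right ends, it matches right and left ends of
  equal rank: arcs do not nest.\<close>

lemma rank_eq: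
  assumes "i \<in> closers \<pi>"
  shows "card (\<pi> ` closers \<pi> \<inter> {1..\<pi> i}) = card (closers \<pi> \<inter> {1..i})"
proof -
  have mono: "\<pi> j \<le> \<pi> i \<longleftrightarrow> j \<le> i" "1 \<le> \<pi> j" "1 \<le> j" if "j \<in> closers \<pi>" for j
  proof -
    have *: "i \<in> {1..n}" "j \<in> {1..n}" "\<pi> j \<in> {1..n}" "\<pi> i \<le> i" "\<pi> j \<le> j"
      using that assms closers_subset involution_in_range_iff[of j] by (auto simp: closers_def)
    show "\<pi> j \<le> \<pi> i \<longleftrightarrow> j \<le> i"
      using mono_weak_deficiencies[of i j] mono_weak_deficiencies[of j i] *
      by (cases i j rule: linorder_cases) auto
    show "1 \<le> \<pi> j" "1 \<le> j" using * by auto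
  qed
  have "\<pi> ` closers \<pi> \<inter> {1..\<pi> i} = \<pi> ` (closers \<pi> \<inter> {1..i})"
    using mono by auto
  then show ?thesis by (simp add: card_image inj_on_def involution_eq_iff)
qed

end

section \<open>An avoiding involution is determined by its right ends\<close>

lemma height_unique:
  fixes h h' :: "nat \<Rightarrow> nat"
  assumes "h n = h' n"
    and "\<And>m. Suc m \<le> n \<Longrightarrow> h m = (if Suc m \<in> S then h (Suc m) + 1 else h (Suc m) - 1)"
    and "\<And>m. Suc m \<le> n \<Longrightarrow> h' m = (if Suc m \<in> S then h' (Suc m) + 1 else h' (Suc m) - 1)"
    and "m \<le> n"
  shows "h m = h' m"
  using assms(4)
  by (induction rule: inc_induct) (simp_all add: assms(1-3) Suc_le_eq)

lemma closers_inj: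
  assumes p: "\<pi> \<in> involutions n" "avoids_321 n \<pi>"
    and s: "\<sigma> \<in> involutions n" "avoids_321 n \<sigma>"
    and eq: "closers \<pi> = closers \<sigma>"
  shows "\<pi> = \<sigma>"
proof -
  have "arcs \<pi> m = arcs \<sigma> m" if "m \<le> n" for m
    by (rule height_unique[where S = "closers \<pi>" and n = n])
       (use that arcs_n[OF p] arcs_n[OF s] arcs_step(1)[OF p] arcs_step(1)[OF s] eq in simp_all)
  then have im: "\<pi> ` closers \<pi> = \<sigma> ` closers \<pi>"
    using image_closers[OF p] image_closers[OF s] eq by (auto simp: openers_def)
  \<comment> \<open>Both images lie in the common set of left ends and have there the rank of
    \<open>i\<close> among the right ends.\<close>
  have on: "\<pi> i = \<sigma> i" if "i \<in> closers \<pi>" for i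
  proof (rule rank_inj[of "\<pi> ` closers \<pi>"])
    show "card (\<pi> ` closers \<pi> \<inter> {1..\<pi> i}) = card (\<pi> ` closers \<pi> \<inter> {1..\<sigma> i})"
      using rank_eq[OF p that] rank_eq[OF s, of i] that eq im by simp
  qed (use that im in auto)
  show ?thesis
  proof
    fix i
    consider "i \<in> closers \<pi>" | "i \<in> \<pi> ` closers \<pi>" | "i \<notin> closers \<pi>" "i \<notin> \<pi> ` closers \<pi>" by blast
    then show "\<pi> i = \<sigma> i"
    proof cases
      case 2
      then obtain j where "j \<in> closers \<pi>" "i = \<pi> j" by blast
      then show ?thesis using on[of j] involutive[OF p, of j] involutive[OF s, of j] by simp
    next
      case 3
      have fixed: "\<tau> i = i"
        if \<tau>: "\<tau> \<in> involutions n" "avoids_321 n \<tau>" and n: "i \<notin> closers \<tau>" "i \<notin> \<tau> ` closers \<tau>" for \<tau>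
      proof (rule ccontr)
        assume "\<tau> i \<noteq> i"
        then have "\<tau> i \<in> closers \<tau>" using n(1) involutive[OF \<tau>, of i] by (simp add: closers_def)
        then have "\<tau> (\<tau> i) \<in> \<tau> ` closers \<tau>" by blast
        then show False using n(2) involutive[OF \<tau>, of i] by simp
      qed
      show ?thesis using fixed[OF p] fixed[OF s] 3 eq im by metis
    qed (rule on)
  qed
qed

subsection \<open>Reconstruction from a ballot set\<close>

text \<open>
  The recursion of \<open>arcs_step\<close>, run from the right end; truncated subtraction accounts for fixed
  points, where the height is 0 on both sides.
\<close>
primrec cover :: "nat \<Rightarrow> nat set \<Rightarrow> nat \<Rightarrow> nat" where
  "cover n S 0 = 0"
| "cover n S (Suc d) = (if n - d \<in> S then cover n S d + 1 else cover n S d - 1)"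

definition height :: "nat \<Rightarrow> nat set \<Rightarrow> nat \<Rightarrow> nat" where
  "height n S m = cover n S (n - m)"

lemma height_step:
  assumes "Suc m \<le> n"
  shows "height n S m = (if Suc m \<in> S then height n S (Suc m) + 1 else height n S (Suc m) - 1)"
proof -
  have "n - m = Suc (n - Suc m)" "n - (n - Suc m) = Suc m" using assms by simp_all
  then show ?thesis by (simp add: height_def)
qed

text \<open>At \<open>m = 0\<close> this forces height 0: every right end finds a left end.\<close>

lemma height_le:
  assumes "ballot n S" "m \<le> n"
  shows "height n S m + 2 * card (S \<inter> {1..m}) \<le> m"
  using assms(2)
proof (induction rule: inc_induct)
  case base
  then show ?case using assms(1) by (simp add: height_def ballot_def)
next
  case (step m)
  \<comment> \<open>Covers the case where truncation holds the height at 0.\<close>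
  moreover have "2 * card (S \<inter> {1..m}) \<le> m" using assms(1) step by (simp add: ballot_def)
  ultimately show ?case using height_step[of m n S] card_Int_Suc[of S m] by auto
qed

text \<open>Each arc begun in the prefix is either closed there or still over the gap after
  \<open>m\<close>. At \<open>m = n\<close> left and right ends are equinumerous.\<close>

lemma card_openers:
  assumes "ballot n S" "m \<le> n"
  shows "card (openers n S (height n S) \<inter> {1..m}) = card (S \<inter> {1..m}) + height n S m"
  using assms(2)
proof (induction m)
  case 0
  then show ?case using height_le[OF assms(1), of 0] by simp
next
  case (Suc m)
  then show ?case
    using height_step[of m n S] card_Int_Suc[of S m] card_Int_Suc[of "openers n S (height n S)" m]
    by (auto simp: openers_def)
qed

lemma rank_bij:
  fixes X :: "nat set"
  assumes "X \<subseteq> {1..n}"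
  shows "bij_betw (\<lambda>i. card (X \<inter> {1..i})) X {1..card X}"
proof -
  have fin: "finite X" using assms by (rule finite_subset) simp
  have inj: "inj_on (\<lambda>i. card (X \<inter> {1..i})) X"
    by (rule inj_onI) (rule rank_inj)
  have "(\<lambda>i. card (X \<inter> {1..i})) ` X \<subseteq> {1..card X}"
  proof
    fix r assume "r \<in> (\<lambda>i. card (X \<inter> {1..i})) ` X"
    then obtain i where i: "i \<in> X" "r = card (X \<inter> {1..i})" by blast
    then have "i \<in> X \<inter> {1..i}" using assms by auto
    then have "r > 0" using i by (auto simp: card_gt_0_iff)
    moreover have "r \<le> card X" using i fin by (simp add: card_mono)
    ultimately show "r \<in> {1..card X}" by simp
  qed
  then have "(\<lambda>i. card (X \<inter> {1..i})) ` X = {1..card X}"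
    by (intro card_subset_eq) (use card_image[OF inj] in simp_all)
  with inj show ?thesis by (simp add: bij_betw_def)
qed

lemma closers_surj:
  assumes S: "ballot n S"
  obtains \<pi> where "\<pi> \<in> involutions n" "avoids_321 n \<pi>" "closers \<pi> = S"
proof -
  define E where "E = openers n S (height n S)"
  define s where "s = (\<lambda>i. card (S \<inter> {1..i}))"
  define e where "e = (\<lambda>i. card (E \<inter> {1..i}))"
  have Ssub: "S \<subseteq> {1..n}" using S by (rule ballot_subset)
  have Esub: "E \<subseteq> {1..n}" and disj: "i \<in> E \<Longrightarrow> i \<notin> S" for i by (auto simp: E_def openers_def)
  have e: "e m = s m + height n S m" if "m \<le> n" for m
    using card_openers[OF S that] by (simp add: e_def s_def E_def)
  have "card E = card S"
    using e[of n] Ssub Esub by (simp add: e_def s_def height_def inf.absorb1)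
  then have bijs: "bij_betw s S {1..card S}" "bij_betw e E {1..card S}"
    using rank_bij[OF Ssub] rank_bij[OF Esub] by (simp_all add: s_def e_def)
  \<comment> \<open>\<open>\<phi>\<close> sends each left end to the right end of the same
    rank.\<close>
  define \<phi> where "\<phi> = inv_into S s \<circ> e"
  have \<phi>: "bij_betw \<phi> E S"
    unfolding \<phi>_def using bijs bij_betw_trans bij_betw_inv_into by blast
  have rank: "s (\<phi> a) = e a" if "a \<in> E" for a
    using bij_betwE[OF bijs(2)] that bij_betw_inv_into_right[OF bijs(1)] by (simp add: \<phi>_def)
  have smono: "i < j" if "s i < s j" for i j
    using that card_Int_mono[of j i S] by (force simp: s_def)
  have emono: "i < j" if "e i < e j" for i j
    using that card_Int_mono[of j i E] by (force simp: e_def)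
  define \<psi> where "\<psi> = inv_into E \<phi>"
  have \<psi>: "bij_betw \<psi> S E" unfolding \<psi>_def using \<phi> by (rule bij_betw_inv_into)
  have \<phi>\<psi>: "\<phi> (\<psi> b) = b" if "b \<in> S" for b
    using \<phi> that by (simp add: \<psi>_def bij_betw_inv_into_right)
  have \<psi>\<phi>: "\<psi> (\<phi> a) = a" if "a \<in> E" for a
    using \<phi> that by (simp add: \<psi>_def bij_betw_inv_into_left)
  have \<phi>S: "\<phi> a \<in> S" if "a \<in> E" for a using \<phi> that by (auto simp: bij_betw_def)
  have \<psi>E: "\<psi> b \<in> E" if "b \<in> S" for b using \<psi> that by (auto simp: bij_betw_def)
  have rank': "e (\<psi> b) = s b" if "b \<in> S" for b using rank[OF \<psi>E[OF that]] \<phi>\<psi>[OF that] by simp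
  \<comment> \<open>The positive height at \<open>a\<close> puts more left than right ends in the
    prefix up to \<open>a\<close>, so the partner of equal rank comes later.\<close>
  have up: "a < \<phi> a" if "a \<in> E" for a
  proof (rule smono)
    have "a \<le> n" "height n S a > 0" using that by (simp_all add: E_def openers_def)
    then show "s a < s (\<phi> a)" using rank[OF that] e[of a] by simp
  qed
  have down: "\<psi> b < b" if "b \<in> S" for b using up[OF \<psi>E[OF that]] \<phi>\<psi>[OF that] by simp
  define \<pi> where "\<pi> i = (if i \<in> E then \<phi> i else if i \<in> S then \<psi> i else i)" for i
  have "i \<in> closers \<pi> \<longleftrightarrow> i \<in> S" for i
    using up[of i] down[of i] disj[of i] by (auto simp: closers_def \<pi>_def)
  then have closers: "closers \<pi> = S" by blast
  have invol: "\<pi> (\<pi> i) = i" for i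
    using \<phi>S[of i] \<psi>E[of i] \<phi>\<psi>[of i] \<psi>\<phi>[of i] disj[of i] disj[of "\<phi> i"] by (auto simp: \<pi>_def)
  have "\<pi> permutes {1..n}"
    unfolding permutes_def
  proof (intro conjI allI impI)
    show "\<pi> i = i" if "i \<notin> {1..n}" for i using that Ssub Esub by (auto simp: \<pi>_def)
    show "\<exists>!i. \<pi> i = j" for j using invol by metis
  qed
  moreover have "\<pi> = Hilbert_Choice.inv \<pi>"
    by (rule sym, rule inv_unique_comp) (simp_all add: fun_eq_iff invol)
  ultimately have "\<pi> \<in> involutions n" by (simp add: involutions_def)
  moreover have "avoids_321 n \<pi>"
  proof -
    \<comment> \<open>\<open>\<pi>\<close> increases on the left ends and, by \<open>F\<close>, on
      their complement.\<close>
    have E: "\<pi> i < \<pi> j" if "i < j" "i \<in> E" "j \<in> E" for i j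
    proof -
      have "e i < e j" unfolding e_def using that by (intro card_Int_strict)
      then have "\<phi> i < \<phi> j" using rank that by (simp add: smono)
      then show ?thesis using that by (simp add: \<pi>_def)
    qed
    have F: "\<pi> i < \<pi> j" if ij: "i < j" and "i \<notin> E" "j \<notin> E" "i \<in> {1..n}" for i j
    proof (cases "j \<in> S")
      case True
      then have "s i < s j" unfolding s_def using ij by (intro card_Int_strict)
      have "\<pi> i \<le> i" "\<pi> j = \<psi> j" using that True down[of i] by (auto simp: \<pi>_def)
      show ?thesis
      proof (cases "i \<in> S")
        case iS: True
        then have "\<psi> i < \<psi> j" using rank' True \<open>s i < s j\<close> by (simp add: emono)
        then show ?thesis using that True iS by (simp add: \<pi>_def)
      next
        case False
        \<comment> \<open>Height 0 at the fixed point \<open>i\<close> means that all earlier arcs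
          are closed, so the arc ending at \<open>j\<close> begins after \<open>i\<close>.\<close>
        then have "height n S i = 0" using that by (auto simp: E_def openers_def)
        then have "e i < e (\<psi> j)" using e[of i] rank'[OF True] \<open>s i < s j\<close> that by simp
        then show ?thesis using emono[of i "\<psi> j"] \<open>\<pi> i \<le> i\<close> \<open>\<pi> j = \<psi> j\<close> by simp
      qed
    next
      case False
      then show ?thesis using that down[of i] by (auto simp: \<pi>_def)
    qed
    show ?thesis
      unfolding avoids_321_def
    proof (intro notI, elim bexE conjE)
      fix i j k
      assume *: "i \<in> {1..n}" "j \<in> {1..n}" "i < j" "j < k" "\<pi> i > \<pi> j" "\<pi> j > \<pi> k"
      show False
        \<comment> \<open>Two of the three positions lie on the same side of \<open>E\<close>, where
          \<open>\<pi>\<close> increases.\<close>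
        using E[of i j] E[of j k] E[of i k] F[of i j] F[of j k] F[of i k] *
        by (cases "i \<in> E"; cases "j \<in> E"; cases "k \<in> E") simp_all
    qed
  qed
  ultimately show ?thesis using closers that by blast
qed

section \<open>Transfer of the count along the bijection\<close>

theorem theorem3p2:
  fixes n k :: nat
  assumes "n \<ge> 1" and "k < n"
  shows "card {\<pi> \<in> involutions n. avoids_321 n \<pi> \<and> card (descents n \<pi>) = k}
         = (nat \<lceil>real n / 2\<rceil> choose k) * (nat \<lfloor>real n / 2\<rfloor> choose k)"
proof -
  let ?A = "{\<pi> \<in> involutions n. avoids_321 n \<pi> \<and> card (descents n \<pi>) = k}"
  have "bij_betw closers ?A {S. ballot n S \<and> card (peaks n S) = k}"
  proof (rule bij_betwI')
    show "closers \<pi> = closers \<sigma> \<longleftrightarrow> \<pi> = \<sigma>" if "\<pi> \<in> ?A" "\<sigma> \<in> ?A" for \<pi> \<sigma>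
      using that closers_inj by blast
    show "closers \<pi> \<in> {S. ballot n S \<and> card (peaks n S) = k}" if "\<pi> \<in> ?A" for \<pi>
      using that ballot_closers descents_eq_peaks by force
    show "\<exists>\<pi>\<in>?A. S = closers \<pi>" if "S \<in> {S. ballot n S \<and> card (peaks n S) = k}" for S
      using that closers_surj[of n S] descents_eq_peaks by (smt (verit) mem_Collect_eq)
  qed
  then have "card ?A = ((n - n div 2) choose k) * ((n div 2) choose k)"
    by (simp add: bij_betw_same_card card_ballot_peaks)
  moreover have "nat \<lceil>real n / 2\<rceil> = n - n div 2" "nat \<lfloor>real n / 2\<rfloor> = n div 2"
    by linarith+
  ultimately show ?thesis by simp
qed

end
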